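(* Let $n\ge 2$ and $k\ge 1$ be integers, and let $X_1,\ldots,X_k$ be $n\times n$ matrices of independent indeterminates. Let $p(X_1,\ldots,X_k)$ be a generalized permanent (as defined in the context). Then there do not exist complex $n\times n$ matrices $B_1,\ldots,B_k,C_1,\ldots,C_k$ (possibly singular), a finite bound $J$, and a polynomial $e$ with complex coefficients in the variables $w_{i,j}$ ($1\le i\le k$, $0\le j\le J$) such that $$p(X_1,\ldots,X_k)=e\big(({\rm trace}(\bar X_i^{\,j}))_{1\le i\le k,\,0\le j\le J}\big),\qquad \text{where } \bar X_i=B_iX_iC_i .$$ In other words, no generalized permanent can be expressed as a polynomial function of the traces of the powers $\bar X_i^{\,j}$, $1\le i\le k$, $j\ge 0$, with $\bar X_i=B_iX_iC_i$ for any complex $n\times n$ matrices $B_i,C_i$.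
   Context: ${\rm perm}(X)$ denotes the permanent of an $n\times n$ matrix $X$. A polynomial function $p(X_1,\ldots,X_k)$ (of any degree) in the entries of $k$ variable $n\times n$ matrices $X_1,\ldots,X_k$ is called a generalized permanent if it has exactly the same symmetries as the permanent, i.e., for all nonsingular complex $n\times n$ matrices $U_i,V_i$ ($i\le k$), one has $p(U_1X_1V_1,\ldots,U_kX_kV_k)=p(X_1,\ldots,X_k)$ (as polynomials) if and only if ${\rm perm}(U_iXV_i)={\rm perm}(X)$ (as polynomials in a variable matrix $X$) for all $i\le k$. *)

theory Defs
  imports "HOL-Analysis.Analysis" "HOL-Library.Poly_Mapping"
begin

text \<open>
  Polynomials with complex coefficients in variables \<^typ>\<open>'v\<close>: finitely supported maps from
  monomials (finitely supported exponent functions) to coefficients, with the convolution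
  product of \<^theory>\<open>HOL-Library.Poly_Mapping\<close>.
\<close>

type_synonym 'v cpoly = "('v \<Rightarrow>\<^sub>0 nat) \<Rightarrow>\<^sub>0 complex"

definition Const :: "complex \<Rightarrow> 'v cpoly" where
  "Const c = Poly_Mapping.single 0 c"

definition Var :: "'v \<Rightarrow> 'v cpoly" where
  "Var v = Poly_Mapping.single (Poly_Mapping.single v 1) 1"

definition cpoly_vars :: "'v cpoly \<Rightarrow> 'v set" where
  "cpoly_vars p = (\<Union>m \<in> Poly_Mapping.keys p. Poly_Mapping.keys m)"

definition subst :: "('v \<Rightarrow> 'w cpoly) \<Rightarrow> 'v cpoly \<Rightarrow> 'w cpoly" where
  "subst f p = (\<Sum>m \<in> Poly_Mapping.keys p.
     Const (Poly_Mapping.lookup p m) *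
     (\<Prod>v \<in> Poly_Mapping.keys m. f v ^ Poly_Mapping.lookup m v))"

definition const_matrix :: "complex^'n^'n \<Rightarrow> ('v cpoly)^'n^'n" where
  "const_matrix A = (\<chi> a b. Const (A $ a $ b))"

primrec matrix_power :: "'a::semiring_1^'n^'n \<Rightarrow> nat \<Rightarrow> 'a^'n^'n" where
  "matrix_power A 0 = mat 1"
| "matrix_power A (Suc j) = A ** matrix_power A j"

definition perm :: "'a::comm_semiring_1^'n^'n \<Rightarrow> 'a" where
  "perm A = (\<Sum>\<sigma> | \<sigma> permutes (UNIV :: 'n set). \<Prod>a\<in>UNIV. A $ a $ \<sigma> a)"

definition generic_matrix :: "(('n \<times> 'n) cpoly)^'n^'n" where
  "generic_matrix = (\<chi> a b. Var (a, b))"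

text \<open>The family \<open>X\<^sub>1, \<dots>, X\<^sub>k\<close> of matrices whose entries are independent indeterminates.\<close>

definition generic_matrices :: "'k \<Rightarrow> (('k \<times> 'n \<times> 'n) cpoly)^'n^'n" where
  "generic_matrices i = (\<chi> a b. Var (i, a, b))"

text \<open>The polynomial \<open>p(M\<^sub>1, \<dots>, M\<^sub>k)\<close>; here \<open>p\<close> itself is \<open>p(X\<^sub>1, \<dots>, X\<^sub>k)\<close>.\<close>

definition at_matrices :: "('k \<times> 'n \<times> 'n) cpoly \<Rightarrow> ('k \<Rightarrow> ('w cpoly)^'n^'n) \<Rightarrow> 'w cpoly" where
  "at_matrices p M = subst (\<lambda>(i, a, b). M i $ a $ b) p"

definition generalized_permanent :: "('k \<times> 'n::finite \<times> 'n) cpoly \<Rightarrow> bool" where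
  "generalized_permanent p \<longleftrightarrow>
     (\<forall>U V :: 'k \<Rightarrow> complex^'n^'n.
        (\<forall>i. invertible (U i) \<and> invertible (V i)) \<longrightarrow>
        (at_matrices p (\<lambda>i. const_matrix (U i) ** generic_matrices i ** const_matrix (V i)) = p
         \<longleftrightarrow>
         (\<forall>i. perm (const_matrix (U i) ** generic_matrix ** const_matrix (V i))
              = perm generic_matrix)))"

end

theory Submission
  imports Defs
begin

text \<open>
  The traces of the powers of \<open>B X C\<close> depend on \<open>X\<close> only through \<open>A X\<close>, where \<open>A = C B\<close>, up to
  conjugation; hence they are invariant under \<open>X \<mapsto> U X V\<close> whenever \<open>V A U = A\<close>. For every \<open>A\<close>
  there is such a pair with \<open>U = I + v e\<^sub>c\<^sup>T\<close> for some \<open>v\<close> with \<open>v\<^sub>a \<noteq> 0\<close>, \<open>a \<noteq> c\<close>: if \<open>A\<close> is invertible,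
  take \<open>v = e\<^sub>a\<close> and \<open>V = A U\<inverse> A\<inverse>\<close>; otherwise take \<open>v\<close> in the kernel of \<open>A\<close>, scaled so that \<open>v\<^sub>c \<noteq> -1\<close>, and \<open>V = I\<close>. Such a pair
  never preserves the permanent, as is seen on matrices of rank one, where
  \<open>perm (y z\<^sup>T) = n! \<Prod>y \<Prod>z\<close>: choose \<open>y\<^sub>a = 0\<close> with no entry of \<open>U y\<close> zero, and \<open>z\<close> with
  \<open>z\<^sup>T V = (1, \<dots>, 1)\<close>.
\<close>

section \<open>Substitution is a ring homomorphism\<close>

lemma Const_0 [simp]: "Const 0 = 0"
  by (simp add: Const_def)

lemma Const_1 [simp]: "Const 1 = 1"
  by (simp add: Const_def)

lemma Const_add: "Const (a + b) = Const a + Const b"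
  by (simp add: Const_def single_add)

lemma Const_mult: "Const (a * b) = Const a * Const b"
  by (simp add: Const_def mult_single)

lemma Const_sum: "Const (sum f S) = (\<Sum>x\<in>S. Const (f x))"
  by (induction S rule: infinite_finite_induct) (auto simp: Const_add)

lemma Const_prod: "Const (prod f S) = (\<Prod>x\<in>S. Const (f x))"
  by (induction S rule: infinite_finite_induct) (auto simp: Const_mult)

lemma Const_eq_iff: "Const a = Const b \<longleftrightarrow> a = b"
  unfolding Const_def by (metis lookup_single_eq)

text \<open>The factor that \<open>subst\<close> attaches to one monomial. Isolated because it turns
  sums of exponents into products, which is what makes \<open>subst\<close> multiplicative.\<close>

definition monom_subst :: "('v \<Rightarrow> 'w cpoly) \<Rightarrow> ('v \<Rightarrow>\<^sub>0 nat) \<Rightarrow> 'w cpoly" where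
  "monom_subst f m = (\<Prod>v \<in> Poly_Mapping.keys m. f v ^ Poly_Mapping.lookup m v)"

text \<open>Variables outside the support contribute a zeroth power. This lets two monomials be
  compared over one common index set.\<close>

lemma monom_subst_superset:
  assumes "finite S" "Poly_Mapping.keys m \<subseteq> S"
  shows "monom_subst f m = (\<Prod>v \<in> S. f v ^ Poly_Mapping.lookup m v)"
  unfolding monom_subst_def using assms
  by (intro prod.mono_neutral_left) (auto simp: in_keys_iff)

lemma monom_subst_0 [simp]: "monom_subst f 0 = 1"
  by (simp add: monom_subst_def)

lemma monom_subst_add: "monom_subst f (m + n) = monom_subst f m * monom_subst f n"
proof -
  let ?S = "Poly_Mapping.keys m \<union> Poly_Mapping.keys n"
  have "Poly_Mapping.keys (m + n) \<subseteq> ?S"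
    by (rule Poly_Mapping.keys_add)
  then show ?thesis
    by (simp add: monom_subst_superset[of ?S] lookup_add power_add prod.distrib)
qed

lemma subst_superset:
  assumes "finite S" "Poly_Mapping.keys p \<subseteq> S"
  shows "subst f p = (\<Sum>m \<in> S. Const (Poly_Mapping.lookup p m) * monom_subst f m)"
  unfolding subst_def monom_subst_def[symmetric] using assms
  by (intro sum.mono_neutral_left) (auto simp: in_keys_iff)

lemma subst_single: "subst f (Poly_Mapping.single m c) = Const c * monom_subst f m"
  by (subst subst_superset[of "{m}"]) auto

lemma subst_0 [simp]: "subst f 0 = 0"
  by (simp add: subst_def)

lemma subst_Const [simp]: "subst f (Const c) = Const c"
  unfolding Const_def[of c] by (simp only: subst_single Const_def monom_subst_0 mult_1_right)

lemma subst_1 [simp]: "subst f 1 = 1"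
  using subst_Const[of f 1] by simp

lemma subst_Var [simp]: "subst f (Var v) = f v"
  by (simp add: Var_def subst_single monom_subst_def)

lemma subst_add: "subst f (p + q) = subst f p + subst f q"
proof -
  let ?S = "Poly_Mapping.keys p \<union> Poly_Mapping.keys q"
  have "Poly_Mapping.keys (p + q) \<subseteq> ?S"
    by (rule Poly_Mapping.keys_add)
  then show ?thesis
    by (simp add: subst_superset[of ?S] lookup_add Const_add distrib_right sum.distrib)
qed

lemma subst_sum: "subst f (sum g S) = (\<Sum>x\<in>S. subst f (g x))"
  by (induction S rule: infinite_finite_induct) (auto simp: subst_add)

lemma subst_mult:
  fixes p q :: "'v cpoly"
  shows "subst f (p * q) = subst f p * subst f q"
proof -
  let ?s = "\<lambda>p m. Poly_Mapping.single m (Poly_Mapping.lookup p m)"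
  \<comment> \<open>By additivity, multiplicativity reduces to products of single terms.\<close>
  have decomp: "r = (\<Sum>m\<in>Poly_Mapping.keys r. ?s r m)" for r :: "'v cpoly"
    by (rule poly_mapping_eqI) (auto simp: lookup_sum lookup_single when_def in_keys_iff)
  have "subst f (p * q) = subst f ((\<Sum>m\<in>Poly_Mapping.keys p. ?s p m) * (\<Sum>n\<in>Poly_Mapping.keys q. ?s q n))"
    by (simp flip: decomp)
  also have "\<dots> = (\<Sum>m\<in>Poly_Mapping.keys p. \<Sum>n\<in>Poly_Mapping.keys q. subst f (?s p m) * subst f (?s q n))"
    by (simp add: sum_product subst_sum mult_single subst_single Const_mult monom_subst_add mult_ac)
  also have "\<dots> = subst f (\<Sum>m\<in>Poly_Mapping.keys p. ?s p m) * subst f (\<Sum>n\<in>Poly_Mapping.keys q. ?s q n)"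
    by (simp add: subst_sum sum_product)
  finally show ?thesis
    by (simp flip: decomp)
qed

lemma subst_prod: "subst f (prod g S) = (\<Prod>x\<in>S. subst f (g x))"
  by (induction S rule: infinite_finite_induct) (auto simp: subst_mult)

lemma subst_power: "subst f (p ^ j) = subst f p ^ j"
  by (induction j) (auto simp: subst_mult)

lemma subst_subst: "subst f (subst g p) = subst (\<lambda>v. subst f (g v)) p"
  by (simp add: subst_def[of g] subst_def[of _ p] subst_sum subst_mult subst_prod subst_power)

section \<open>Matrices of polynomials\<close>

lemma map_matrix_subst_mult: "map_matrix (subst f) (A ** B) = map_matrix (subst f) A ** map_matrix (subst f) B"
  by (simp add: map_matrix_def matrix_matrix_mult_def vec_eq_iff subst_sum subst_mult)

lemma map_matrix_subst_const [simp]: "map_matrix (subst f) (const_matrix A) = const_matrix A"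
  by (simp add: map_matrix_def const_matrix_def)

lemma map_matrix_subst_power: "map_matrix (subst f) (matrix_power A j) = matrix_power (map_matrix (subst f) A) j"
proof (induction j)
  case 0
  show ?case by (simp add: map_matrix_def mat_def vec_eq_iff)
qed (simp add: map_matrix_subst_mult)

lemma subst_trace: "subst f (trace A) = trace (map_matrix (subst f) A)"
  by (simp add: map_matrix_def trace_def subst_sum)

lemma subst_perm: "subst f (perm A) = perm (map_matrix (subst f) A)"
  by (simp add: map_matrix_def perm_def subst_sum subst_prod)

lemma const_matrix_mult: "const_matrix (A ** B) = const_matrix A ** const_matrix B"
  by (simp add: const_matrix_def matrix_matrix_mult_def vec_eq_iff Const_sum Const_mult)

lemma perm_const_matrix: "perm (const_matrix A) = Const (perm A)"
  by (simp add: const_matrix_def perm_def Const_sum Const_prod)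

text \<open>Rebracketing MN MN ... MN leaves an outer M and N around j copies of NM.\<close>

lemma matrix_power_mult_Suc:
  fixes M N :: "'a::comm_semiring_1^'n^'n"
  shows "matrix_power (M ** N) (Suc j) = M ** matrix_power (N ** M) j ** N"
  by (induction j) (simp_all add: matrix_mul_assoc)

lemma trace_matrix_power_commute:
  fixes M N :: "'a::comm_semiring_1^'n^'n"
  shows "trace (matrix_power (M ** N) j) = trace (matrix_power (N ** M) j)"
proof (cases j)
  case (Suc i)
  have "trace (matrix_power (M ** N) j) = trace (N ** (M ** matrix_power (N ** M) i))"
    unfolding Suc matrix_power_mult_Suc by (rule trace_mul_sym)
  then show ?thesis
    by (simp add: Suc matrix_mul_assoc)
qed simp

text \<open>Cyclicity of the trace moves V C to the front, where it meets B U; the assumption then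
  collapses V C B U to C B, and a second cyclic move restores the original order.\<close>

lemma trace_power_invariant:
  fixes B C U V :: "complex^'n^'n" and G :: "('v cpoly)^'n^'n"
  assumes "V ** (C ** B) ** U = C ** B"
  shows "trace (matrix_power (const_matrix B ** (const_matrix U ** G ** const_matrix V) ** const_matrix C) j)
       = trace (matrix_power (const_matrix B ** G ** const_matrix C) j)"
proof -
  let ?c = "const_matrix :: complex^'n^'n \<Rightarrow> ('v cpoly)^'n^'n"
  have "?c V ** ?c C ** (?c B ** ?c U ** G) = ?c V ** (?c C ** ?c B) ** ?c U ** G"
    by (simp add: matrix_mul_assoc)
  also have "\<dots> = ?c C ** ?c B ** G"
    by (simp only: assms flip: const_matrix_mult)
  also have "\<dots> = ?c C ** (?c B ** G)"
    by (simp add: matrix_mul_assoc)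
  finally have "trace (matrix_power ((?c B ** ?c U ** G) ** (?c V ** ?c C)) j)
      = trace (matrix_power ((?c B ** G) ** ?c C) j)"
    by (simp only: trace_matrix_power_commute)
  then show ?thesis
    by (simp add: matrix_mul_assoc)
qed

text \<open>Replacing each X_i by U_i X_i V_i fixes every trace that is fed into \<open>e\<close>,
  hence fixes \<open>p\<close>.\<close>

lemma at_matrices_trace_powers:
  fixes B C U V :: "'k \<Rightarrow> complex^'n^'n" and e :: "('k \<times> nat) cpoly"
  assumes "\<And>i. V i ** (C i ** B i) ** U i = C i ** B i"
    and p: "p = subst (\<lambda>(i, j). trace (matrix_power
                 (const_matrix (B i) ** generic_matrices i ** const_matrix (C i)) j)) e"
  shows "at_matrices p (\<lambda>i. const_matrix (U i) ** generic_matrices i ** const_matrix (V i)) = p"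
proof -
  let ?M = "\<lambda>i. const_matrix (U i) ** generic_matrices i ** const_matrix (V i)"
  let ?f = "\<lambda>(i, a, b). ?M i $ a $ b"
  have "map_matrix (subst ?f) (generic_matrices i) = ?M i" for i
    by (simp add: map_matrix_def generic_matrices_def vec_eq_iff)
  then have "subst ?f (trace (matrix_power (const_matrix (B i) ** generic_matrices i ** const_matrix (C i)) j))
      = trace (matrix_power (const_matrix (B i) ** generic_matrices i ** const_matrix (C i)) j)" for i j
    by (simp add: subst_trace map_matrix_subst_power map_matrix_subst_mult trace_power_invariant assms)
  then show ?thesis
    unfolding at_matrices_def p by (simp add: subst_subst case_prod_unfold)
qed

section \<open>Pairs that do not preserve the permanent\<close>

text \<open>Each of the n! permutations contributes the same product, since it only reorders the
  factors of z.\<close>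

lemma perm_outer_product:
  fixes y z :: "'a::comm_semiring_1^'n"
  shows "perm (\<chi> a b. y $ a * z $ b) = of_nat (fact CARD('n)) * (\<Prod>a\<in>UNIV. y $ a) * (\<Prod>b\<in>UNIV. z $ b)"
proof -
  have "(\<Prod>a\<in>UNIV. z $ \<sigma> a) = (\<Prod>b\<in>UNIV. z $ b)" if "\<sigma> permutes (UNIV :: 'n set)" for \<sigma>
    using prod.permute[OF that, of "\<lambda>b. z $ b"] by (simp add: o_def)
  then have "perm (\<chi> a b. y $ a * z $ b)
      = (\<Sum>\<sigma> | \<sigma> permutes (UNIV :: 'n set). (\<Prod>a\<in>UNIV. y $ a) * (\<Prod>b\<in>UNIV. z $ b))"
    by (simp add: perm_def prod.distrib)
  then show ?thesis
    by (simp add: card_permutations[OF refl] mult.assoc)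
qed

lemma perm_symmetry_eval:
  fixes U V X :: "complex^'n^'n"
  assumes "perm (const_matrix U ** generic_matrix ** const_matrix V) = perm generic_matrix"
  shows "perm (U ** X ** V) = perm X"
proof -
  \<comment> \<open>All substituted values are constants, so \<open>unit\<close> merely serves as
    some type of variables.\<close>
  let ?f = "\<lambda>(a, b). Const (X $ a $ b) :: unit cpoly"
  have "map_matrix (subst ?f) generic_matrix = const_matrix X"
    by (simp add: map_matrix_def generic_matrix_def const_matrix_def vec_eq_iff)
  then have "Const (perm (U ** X ** V)) = (Const (perm X) :: unit cpoly)"
    using arg_cong[OF assms, of "subst ?f"]
    by (simp add: subst_perm map_matrix_subst_mult flip: perm_const_matrix const_matrix_mult)
  then show ?thesis
    by (simp add: Const_eq_iff)
qed

text \<open>The matrix I + v e_c^T: multiplying A by it on the right adds A v to column c of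
  A.\<close>

definition add_col :: "'n \<Rightarrow> 'a::comm_ring_1^'n \<Rightarrow> 'a^'n^'n" where
  "add_col c v = (\<chi> a b. (if a = b then 1 else 0) + (if b = c then v $ a else 0))"

lemma add_col_vec: "(add_col c v *v x) $ a = x $ a + v $ a * x $ c"
proof -
  have "(add_col c v *v x) $ a
      = (\<Sum>b\<in>UNIV. (if a = b then x $ b else 0) + (if b = c then v $ a * x $ b else 0))"
    by (auto simp: add_col_def matrix_vector_mult_def distrib_right intro!: sum.cong)
  then show ?thesis
    by (simp add: sum.distrib)
qed

lemma mult_add_col:
  assumes "A *v v = 0"
  shows "A ** add_col c v = A"
proof -
  have "(A ** add_col c v) $ a $ b
      = (\<Sum>k\<in>UNIV. (if k = b then A $ a $ k else 0) + (if b = c then A $ a $ k * v $ k else 0))" for a b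
    by (auto simp: add_col_def matrix_matrix_mult_def distrib_left intro!: sum.cong)
  then have "(A ** add_col c v) $ a $ b = A $ a $ b + (if b = c then (A *v v) $ a else 0)" for a b
    by (simp add: matrix_vector_mult_def sum.distrib)
  then show ?thesis
    by (simp add: assms vec_eq_iff)
qed

text \<open>A kernel vector x satisfies (1 + v_c) x_c = 0 in coordinate c, so x_c = 0, and then
  every other coordinate vanishes as well.\<close>

lemma invertible_add_col:
  fixes v :: "'a::field^'n"
  assumes "1 + v $ c \<noteq> 0"
  shows "invertible (add_col c v)"
  unfolding invertible_left_inverse matrix_left_invertible_ker
proof (intro allI impI)
  fix x assume "add_col c v *v x = 0"
  then have *: "x $ a + v $ a * x $ c = 0" for a
    by (metis add_col_vec zero_index)
  then have "(1 + v $ c) * x $ c = 0"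
    by (simp add: distrib_right)
  with assms * show "x = 0"
    by (simp add: vec_eq_iff)
qed

lemma add_col_not_perm_symmetry:
  fixes V :: "complex^'n^'n"
  assumes "v $ a \<noteq> 0" "1 + v $ c \<noteq> 0" "a \<noteq> c" "invertible V"
  shows "perm (const_matrix (add_col c v) ** generic_matrix ** const_matrix V) \<noteq> perm generic_matrix"
proof
  assume sym: "perm (const_matrix (add_col c v) ** generic_matrix ** const_matrix V) = perm generic_matrix"
  \<comment> \<open>Since y_c = 1, the image is y + v, with entries v_a at a, 1 + v_c at c and 1
    elsewhere.\<close>
  define y :: "complex^'n" where "y = (\<chi> b. if b = a then 0 else if b = c then 1 else 1 - v $ b)"
  obtain W where W: "W ** V = mat 1"
    using assms(4) by (auto simp: invertible_def)
  \<comment> \<open>Here \<open>1\<close> is the all-ones vector.\<close>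
  define z where "z = 1 v* W"
  define X where "X = (\<chi> a b. y $ a * z $ b)"
  have zV: "z v* V = 1"
    by (simp add: z_def vector_matrix_mul_assoc W)
  \<comment> \<open>U (y z^T) V = (U y)(z^T V) is again of rank one.\<close>
  have "(add_col c v ** X ** V) $ a $ b = (add_col c v *v y) $ a * (z v* V) $ b" for a b
    by (simp add: X_def matrix_matrix_mult_def matrix_vector_mult_def vector_matrix_mult_def
        sum_distrib_left sum_distrib_right mult_ac) (rule sum.swap)
  then have "add_col c v ** X ** V = (\<chi> a b. (add_col c v *v y) $ a * 1 $ b)"
    by (simp add: vec_eq_iff zV)
  then have "perm (add_col c v ** X ** V) = fact CARD('n) * (\<Prod>b\<in>UNIV. (add_col c v *v y) $ b)"
    by (simp only: perm_outer_product) simp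
  moreover have "(add_col c v *v y) $ b \<noteq> 0" for b
    using assms by (auto simp: add_col_vec y_def)
  moreover have "perm X = 0"
    unfolding X_def perm_outer_product by (auto simp: y_def)
  ultimately show False
    using perm_symmetry_eval[OF sym, of X] by simp
qed

lemma ex_distinct_element:
  assumes "CARD('n) \<ge> 2"
  shows "\<exists>c. (a :: 'n) \<noteq> c"
proof (rule ccontr)
  assume "\<nexists>c. a \<noteq> c"
  then have "(UNIV :: 'n set) = {a}"
    by auto
  then have "CARD('n) = card {a}"
    by (rule arg_cong)
  with assms show False
    by simp
qed

lemma ex_stabilizing_pair_not_perm_symmetry:
  fixes A :: "complex^'n^'n"
  assumes "CARD('n) \<ge> 2"
  shows "\<exists>U V. invertible U \<and> invertible V \<and> V ** A ** U = A \<and>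
    perm (const_matrix U ** generic_matrix ** const_matrix V) \<noteq> perm generic_matrix"
proof (cases "invertible A")
  case True
  obtain a c :: 'n where "a \<noteq> c"
    using ex_distinct_element[OF assms] by blast
  define U :: "complex^'n^'n" where "U = add_col c (axis a 1)"
  have U: "invertible U"
    using \<open>a \<noteq> c\<close> by (auto simp: U_def axis_def intro!: invertible_add_col)
  then obtain U' where U': "U ** U' = mat 1" "U' ** U = mat 1"
    by (auto simp: invertible_def)
  obtain A' where A': "A ** A' = mat 1" "A' ** A = mat 1"
    using True by (auto simp: invertible_def)
  \<comment> \<open>The unique solution of V A U = A when A and U are invertible.\<close>
  define V where "V = A ** U' ** A'"
  have "invertible U'" "invertible A'"
    using U' A' unfolding invertible_def by blast+
  with True have V: "invertible V"
    unfolding V_def by (intro invertible_mult)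
  have "V ** A ** U = A ** (U' ** (A' ** A) ** U)"
    by (simp only: V_def matrix_mul_assoc)
  then have "V ** A ** U = A"
    by (simp add: U' A')
  moreover have "perm (const_matrix U ** generic_matrix ** const_matrix V) \<noteq> perm generic_matrix"
    unfolding U_def using V \<open>a \<noteq> c\<close>
    by (intro add_col_not_perm_symmetry[of _ a]) (auto simp: axis_def)
  ultimately show ?thesis
    using U V by (intro exI[of _ U] exI[of _ V]) simp
next
  case False
  then obtain v where "A *v v = 0" "v \<noteq> 0"
    unfolding invertible_left_inverse matrix_left_invertible_ker by blast
  then obtain a where a: "v $ a \<noteq> 0"
    by (auto simp: vec_eq_iff)
  obtain c where "a \<noteq> c"
    using ex_distinct_element[OF assms] by blast
  \<comment> \<open>Doubling stays in the kernel and keeps entry a nonzero, while it turns v_c = -1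
    into -2.\<close>
  define w where "w = (if v $ c = - 1 then 2 *s v else v)"
  have w: "w $ a \<noteq> 0" "1 + w $ c \<noteq> 0"
    using a by (auto simp: w_def add_eq_0_iff)
  have "A *v w = 0"
    using \<open>A *v v = 0\<close> by (auto simp: w_def vector_scalar_commute)
  then have "mat 1 ** A ** add_col c w = A"
    by (simp add: mult_add_col)
  moreover have "invertible (mat 1 :: complex^'n^'n)"
    unfolding invertible_def by (intro exI[of _ "mat 1"]) simp
  ultimately show ?thesis
    using invertible_add_col[OF w(2)] add_col_not_perm_symmetry[OF w \<open>a \<noteq> c\<close>, of "mat 1"]
    by (intro exI[of _ "add_col c w"] exI[of _ "mat 1"]) simp
qed

theorem theorem1p2p4:
  fixes p :: "('k::finite \<times> 'n::finite \<times> 'n) cpoly"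
  assumes "CARD('n) \<ge> 2"
    and "CARD('k) \<ge> 1"
    and "generalized_permanent p"
  shows "\<nexists>(B :: 'k \<Rightarrow> complex^'n^'n) (C :: 'k \<Rightarrow> complex^'n^'n) (J :: nat) (e :: ('k \<times> nat) cpoly).
           cpoly_vars e \<subseteq> UNIV \<times> {0..J} \<and>
           p = subst (\<lambda>(i, j). trace (matrix_power
                 (const_matrix (B i) ** generic_matrices i ** const_matrix (C i)) j)) e"
proof (intro notI, elim exE conjE)
  fix B C :: "'k \<Rightarrow> complex^'n^'n" and J and e :: "('k \<times> nat) cpoly"
  assume p: "p = subst (\<lambda>(i, j). trace (matrix_power
                 (const_matrix (B i) ** generic_matrices i ** const_matrix (C i)) j)) e"
  \<comment> \<open>One pair per index, taken for A = C_i B_i: together the pairs preserve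
    \<open>p\<close>, yet each of them changes the permanent.\<close>
  have "\<forall>i. \<exists>U V. invertible U \<and> invertible V \<and> V ** (C i ** B i) ** U = C i ** B i \<and>
      perm (const_matrix U ** generic_matrix ** const_matrix V) \<noteq> perm generic_matrix"
    using ex_stabilizing_pair_not_perm_symmetry[OF assms(1)] by blast
  then obtain U V where UV: "\<And>i. invertible (U i)" "\<And>i. invertible (V i)"
      "\<And>i. V i ** (C i ** B i) ** U i = C i ** B i"
      "\<And>i. perm (const_matrix (U i) ** generic_matrix ** const_matrix (V i)) \<noteq> perm generic_matrix"
    unfolding choice_iff by blast
  then show False
    using assms(3) at_matrices_trace_powers[OF UV(3) p] unfolding generalized_permanent_def by blast
qed

end
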